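(* Let $Z\subset S\setminus\{0\}$ be the set of nontrivial (that is, nonzero) left zero-divisors of the sedenion algebra $S$. Then \[ Z\cong(0,\infty)\times V_2(\mathbb{R}^7) \] as smooth manifolds. In particular, $\dim Z=1+\dim V_2(\mathbb{R}^7)=1+(2\cdot 7-3)=12$.
   Context: $\mathbb{O}$ is the real algebra of octonions with unit $e_0=1$, conjugation $x\mapsto\overline{x}$, standard Euclidean inner product $\langle\cdot,\cdot\rangle$ and norm $\|\cdot\|$ on $\mathbb{O}\cong\mathbb{R}^8$ (so $x\overline{x}=\|x\|^2e_0$), and $\operatorname{Im}(\mathbb{O})=e_0^{\perp}\cong\mathbb{R}^7$ its subspace of purely imaginary octonions. Concretely, $\mathbb{O}=\mathbb{H}\oplus\mathbb{H}e_4$ with product $(x+ye_4)(z+te_4)=(xz-\overline{t}\,y)+(tx+y\overline{z})e_4$ and conjugation $\overline{x+ye_4}=\overline{x}-ye_4$, where $\mathbb{H}=\operatorname{span}\{e_0,e_1,e_2,e_3\}$ is the quaternion algebra. The sedenion algebra $S$ is the real vector space $\mathbb{O}\oplus\mathbb{O}\cong\mathbb{R}^{16}$, whose elements are written uniquely as $v=v_1+v_2e_8$ with $v_1,v_2\in\mathbb{O}$, with multiplication \[ (a+be_8)(c+de_8)=(ac-\overline{d}\,b)+(da+b\overline{c})e_8,\qquad a,b,c,d\in\mathbb{O}. \] An element $v\in S$ is a left zero-divisor if there exists $y\in S$, $y\neq 0$, with $vy=0$. $V_2(\mathbb{R}^7)=\{(u,w)\in\mathbb{R}^7\times\mathbb{R}^7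 : \|u\|=\|w\|=1,\ \langle u,w\rangle=0\}$ is the Stiefel manifold of orthonormal pairs, here with $\mathbb{R}^7\cong\operatorname{Im}(\mathbb{O})$. The set $Z$ carries the smooth structure induced from the ambient space $S\cong\mathbb{R}^{16}$. *)

theory Defs
  imports "HOL-Analysis.Analysis"
begin

section \<open>Quaternions, octonions and sedenions\<close>

text \<open>
  The algebras are carried by iterated products, so that \<^verbatim>\<open>+\<close>, \<^verbatim>\<open>inner\<close>, \<^verbatim>\<open>norm\<close> and the
  topology are the library's ones for products; these are the standard Euclidean structures
  of dimension 4, 8 and 16. The tuple \<^verbatim>\<open>(a, b, c, d)\<close> stands for
  \<open>a e\<^sub>0 + b e\<^sub>1 + c e\<^sub>2 + d e\<^sub>3\<close>, the pair of quaternions \<^verbatim>\<open>(x, y)\<close> for \<open>x + y e\<^sub>4\<close>, and the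
  pair of octonions \<^verbatim>\<open>(a, b)\<close> for \<open>a + b e\<^sub>8\<close>.
\<close>

type_synonym quat = "real \<times> real \<times> real \<times> real"
type_synonym oct = "quat \<times> quat"
type_synonym sed = "oct \<times> oct"

fun quat_mult :: "quat \<Rightarrow> quat \<Rightarrow> quat" where
  "quat_mult (a, b, c, d) (a', b', c', d') =
    (a * a' - b * b' - c * c' - d * d',
     a * b' + b * a' + c * d' - d * c',
     a * c' - b * d' + c * a' + d * b',
     a * d' + b * c' - c * b' + d * a')"

fun quat_cnj :: "quat \<Rightarrow> quat" where
  "quat_cnj (a, b, c, d) = (a, - b, - c, - d)"

fun oct_mult :: "oct \<Rightarrow> oct \<Rightarrow> oct" where
  "oct_mult (x, y) (z, t) =
    (quat_mult x z - quat_mult (quat_cnj t) y, quat_mult t x + quat_mult y (quat_cnj z))"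

fun oct_cnj :: "oct \<Rightarrow> oct" where
  "oct_cnj (x, y) = (quat_cnj x, - y)"

fun sed_mult :: "sed \<Rightarrow> sed \<Rightarrow> sed" where
  "sed_mult (a, b) (c, d) =
    (oct_mult a c - oct_mult (oct_cnj d) b, oct_mult d a + oct_mult b (oct_cnj c))"

definition left_zero_divisor :: "sed \<Rightarrow> bool" where
  "left_zero_divisor v \<longleftrightarrow> (\<exists>y. y \<noteq> 0 \<and> sed_mult v y = 0)"

definition nontrivial_left_zero_divisors :: "sed set" where
  "nontrivial_left_zero_divisors = {v. v \<noteq> 0 \<and> left_zero_divisor v}"


section \<open>The Stiefel manifold of orthonormal pairs\<close>

definition stiefel2 :: "('a::euclidean_space \<times> 'a) set" where
  "stiefel2 = {(u, w). norm u = 1 \<and> norm w = 1 \<and> inner u w = 0}"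


section \<open>Smooth maps and embedded submanifolds of Euclidean spaces\<close>

text \<open>
  \<^verbatim>\<open>Ck_on k f U\<close> is meant for open \<^verbatim>\<open>U\<close>. The spaces being finite-dimensional, requiring each
  directional derivative \<^verbatim>\<open>\<lambda>x. f' x v\<close> to be of class \<open>C\<^sup>k\<close> amounts to requiring the
  derivative \<^verbatim>\<open>f'\<close>, as an operator-valued map, to be of class \<open>C\<^sup>k\<close>.
\<close>

primrec Ck_on :: "nat \<Rightarrow> ('a::euclidean_space \<Rightarrow> 'b::euclidean_space) \<Rightarrow> 'a set \<Rightarrow> bool" where
  "Ck_on 0 f U \<longleftrightarrow> continuous_on U f"
| "Ck_on (Suc k) f U \<longleftrightarrow>
    (\<exists>f'. (\<forall>x\<in>U. (f has_derivative f' x) (at x)) \<and> (\<forall>v. Ck_on k (\<lambda>x. f' x v) U))"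

text \<open>
  A map on an arbitrary subset of a Euclidean space is smooth if it locally extends to a
  \<open>C\<^sup>\<infinity>\<close> map on an open set of the ambient space. On an embedded submanifold this is smoothness
  with respect to the smooth structure induced from the ambient space.
\<close>

definition smooth_map :: "'a::euclidean_space set \<Rightarrow> ('a \<Rightarrow> 'b::euclidean_space) \<Rightarrow> bool" where
  "smooth_map A f \<longleftrightarrow>
    (\<forall>x\<in>A. \<exists>U g. open U \<and> x \<in> U \<and> (\<forall>k. Ck_on k g U) \<and> (\<forall>y\<in>A \<inter> U. g y = f y))"

definition diffeomorphism ::
  "'a::euclidean_space set \<Rightarrow> 'b::euclidean_space set \<Rightarrow> ('a \<Rightarrow> 'b) \<Rightarrow> ('b \<Rightarrow> 'a) \<Rightarrow> bool" where
  "diffeomorphism A B f g \<longleftrightarrow>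
    smooth_map A f \<and> smooth_map B g \<and> f ` A = B \<and> g ` B = A \<and>
    (\<forall>x\<in>A. g (f x) = x) \<and> (\<forall>y\<in>B. f (g y) = y)"

definition diffeomorphic :: "'a::euclidean_space set \<Rightarrow> 'b::euclidean_space set \<Rightarrow> bool"
    (infix "diffeomorphic" 60) where
  "A diffeomorphic B \<longleftrightarrow> (\<exists>f g. diffeomorphism A B f g)"

text \<open>
  Slice charts: near each of its points, \<^verbatim>\<open>M\<close> is straightened by a diffeomorphism of open sets
  of the ambient space to a piece of a \<^verbatim>\<open>d\<close>-dimensional linear subspace. A nonempty \<^verbatim>\<open>M\<close>
  satisfies this for at most one \<^verbatim>\<open>d\<close>.
\<close>

definition embedded_submanifold :: "nat \<Rightarrow> 'a::euclidean_space set \<Rightarrow> bool" where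
  "embedded_submanifold d M \<longleftrightarrow>
    (\<forall>p\<in>M. \<exists>U V E (\<phi> :: 'a \<Rightarrow> 'a) \<psi>. open U \<and> p \<in> U \<and> open V \<and> diffeomorphism U V \<phi> \<psi> \<and>
      subspace E \<and> dim E = d \<and> \<phi> ` (M \<inter> U) = E \<inter> V)"

end

theory Submission
  imports Defs
begin

text \<open>
  Two facts carry the theorem: an algebraic description of the zero-divisors, and the regular
  value theorem.

  \<^bold>\<open>Algebra.\<close> For \<open>v = (a, b)\<close> and \<open>y = (c, d)\<close>, the equation \<open>v y = 0\<close> means
  \<open>a c = d\<^sup>* b\<close> and \<open>d a = - b c\<^sup>*\<close>. Left multiplication by an octonion \<open>x\<close> has left multiplication
  by \<open>x\<^sup>*\<close> as its adjoint, and likewise on the right; octonion norms are multiplicative. Pairing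
  the two equations with suitable products therefore yields
  \<open>t (\<parallel>c\<parallel>\<^sup>2 + \<parallel>d\<parallel>\<^sup>2) = 0\<close> for each of \<open>t = Re a\<close>, \<open>Re b\<close>, \<open>\<langle>a, b\<rangle>\<close> and
  \<open>\<parallel>a\<parallel>\<^sup>2 - \<parallel>b\<parallel>\<^sup>2\<close> (\<open>zero_divisor_necessary\<close>). Conversely, if all four vanish and \<open>b \<noteq> 0\<close>, any
  nonzero \<open>e\<close> orthogonal to \<open>1, a, b, b a\<close> anti-associates with \<open>b\<close> and \<open>a\<close>, and
  \<open>y = ((e a)\<^sup>*, b e)\<close> is annihilated by \<open>v\<close> (\<open>zero_divisor_sufficient\<close>). So the nonzero left
  zero-divisors are exactly the pairs of orthogonal imaginary octonions of equal positive length
  (\<open>nontrivial_left_zero_divisors_iff\<close>). Dividing by the common length and identifying the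
  imaginary octonions isometrically with \<open>\<real>\<^sup>7\<close> gives the diffeomorphism.

  \<^bold>\<open>Analysis.\<close> Each of the three sets is a level set, within an open set, of a map with
  polynomial coordinates whose derivative is surjective along that level set, so it is an embedded submanifold of the
  expected dimension (\<open>regular_level_set_submanifold\<close>). The charts come from a local
  inverse, which is differentiable by the inverse function theorem; that it is
  of class \<open>C\<^sup>k\<close> for all \<open>k\<close> follows from \<open>g' = (f' \<circ> g)\<^sup>-\<^sup>1\<close> by induction, as soon as inversion of
  operators is known to preserve the class \<open>C\<^sup>k\<close> (\<open>Ck_on_inv_family\<close>).
\<close>

section \<open>Calculus of maps of class \<open>C\<^sup>k\<close>\<close>

declare Ck_on.simps(2) [simp del]

lemma Ck_on_continuous: "Ck_on k f U \<Longrightarrow> continuous_on U f"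
proof (cases k)
  case (Suc n)
  assume "Ck_on k f U"
  then obtain f' where "\<forall>x\<in>U. (f has_derivative f' x) (at x)" using Suc by (auto simp: Ck_on.simps(2))
  then show ?thesis
    by (meson continuous_at_imp_continuous_on has_derivative_continuous)
qed simp

lemma Ck_on_SucD: "Ck_on (Suc k) f U \<Longrightarrow> Ck_on k f U"
proof (induction k arbitrary: f)
  case 0
  then show ?case using Ck_on_continuous by (metis Ck_on.simps(1))
next
  case (Suc k)
  from Suc.prems obtain f' where
    f': "\<forall>x\<in>U. (f has_derivative f' x) (at x)" "\<forall>v. Ck_on (Suc k) (\<lambda>x. f' x v) U"
    by (subst (asm) Ck_on.simps) blast
  then have "\<forall>v. Ck_on k (\<lambda>x. f' x v) U" using Suc.IH by blast
  with f' show ?case by (subst Ck_on.simps) blast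
qed

lemma Ck_on_SucI:
  assumes "\<And>x. x \<in> U \<Longrightarrow> (f has_derivative f' x) (at x)" "\<And>v. Ck_on k (\<lambda>x. f' x v) U"
  shows "Ck_on (Suc k) f U"
  using assms by (auto simp: Ck_on.simps(2))

lemma Ck_on_SucE:
  assumes "Ck_on (Suc k) f U"
  obtains f' where "\<And>x. x \<in> U \<Longrightarrow> (f has_derivative f' x) (at x)" "\<And>v. Ck_on k (\<lambda>x. f' x v) U"
  using assms by (auto simp: Ck_on.simps(2))

lemma Ck_on_cong:
  assumes "open U" "Ck_on k f U" "\<And>x. x \<in> U \<Longrightarrow> g x = f x"
  shows "Ck_on k g U"
proof (cases k)
  case 0
  then show ?thesis using assms continuous_on_cong by force
next
  case (Suc n)
  with assms(2) have "Ck_on (Suc n) f U" by simp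
  then obtain f' where
    f': "\<And>x. x \<in> U \<Longrightarrow> (f has_derivative f' x) (at x)" "\<And>v. Ck_on n (\<lambda>x. f' x v) U"
    by (rule Ck_on_SucE) blast
  have "(g has_derivative f' x) (at x)" if "x \<in> U" for x
    using has_derivative_transform_within_open[OF f'(1)[OF that] assms(1) that] assms(3) by metis
  with f'(2) Suc show ?thesis by (auto intro: Ck_on_SucI)
qed

lemma Ck_on_const: "Ck_on k (\<lambda>x. c) U"
proof (induction k arbitrary: c)
  case (Suc k)
  show ?case by (rule Ck_on_SucI[where f' = "\<lambda>x v. 0"]) (auto intro: Suc)
qed simp

lemma Ck_on_linear:
  assumes "linear f" shows "Ck_on k f U"
proof (cases k)
  case 0
  then show ?thesis using assms linear_continuous_on linear_conv_bounded_linear by auto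
next
  case (Suc n)
  have "(f has_derivative f) (at x)" for x
    using assms bounded_linear_imp_has_derivative linear_conv_bounded_linear by blast
  then show ?thesis unfolding Suc by (intro Ck_on_SucI[where f' = "\<lambda>x. f"]) (auto intro: Ck_on_const)
qed

lemma Ck_on_Pair:
  "Ck_on k f U \<Longrightarrow> Ck_on k g U \<Longrightarrow> Ck_on k (\<lambda>x. (f x, g x)) U"
proof (induction k arbitrary: f g)
  case 0
  then show ?case by (auto intro: continuous_on_Pair)
next
  case (Suc k)
  obtain f' where f': "\<And>x. x \<in> U \<Longrightarrow> (f has_derivative f' x) (at x)" "\<And>v. Ck_on k (\<lambda>x. f' x v) U"
    using Suc.prems(1) by (rule Ck_on_SucE) blast
  obtain g' where g': "\<And>x. x \<in> U \<Longrightarrow> (g has_derivative g' x) (at x)" "\<And>v. Ck_on k (\<lambda>x. g' x v) U"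
    using Suc.prems(2) by (rule Ck_on_SucE) blast
  show ?case
    by (rule Ck_on_SucI[where f' = "\<lambda>x v. (f' x v, g' x v)"])
       (auto intro: has_derivative_Pair f' g' Suc.IH)
qed

lemma Ck_on_add:
  "Ck_on k f U \<Longrightarrow> Ck_on k g U \<Longrightarrow> Ck_on k (\<lambda>x. f x + g x) U"
proof (induction k arbitrary: f g)
  case 0
  then show ?case by (auto intro: continuous_on_add)
next
  case (Suc k)
  obtain f' where f': "\<And>x. x \<in> U \<Longrightarrow> (f has_derivative f' x) (at x)" "\<And>v. Ck_on k (\<lambda>x. f' x v) U"
    using Suc.prems(1) by (rule Ck_on_SucE) blast
  obtain g' where g': "\<And>x. x \<in> U \<Longrightarrow> (g has_derivative g' x) (at x)" "\<And>v. Ck_on k (\<lambda>x. g' x v) U"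
    using Suc.prems(2) by (rule Ck_on_SucE) blast
  show ?case
    by (rule Ck_on_SucI[where f' = "\<lambda>x v. f' x v + g' x v"])
       (auto intro: has_derivative_add f' g' Suc.IH)
qed

lemma Ck_on_sum:
  "(\<And>i. i \<in> I \<Longrightarrow> Ck_on k (f i) U) \<Longrightarrow> Ck_on k (\<lambda>x. \<Sum>i\<in>I. f i x) U"
  by (induction I rule: infinite_finite_induct) (auto intro: Ck_on_add Ck_on_const)

lemma Ck_on_bilinear:
  assumes "bounded_bilinear mul"
  shows "Ck_on k f U \<Longrightarrow> Ck_on k g U \<Longrightarrow> Ck_on k (\<lambda>x. mul (f x) (g x)) U"
proof (induction k arbitrary: f g)
  case 0
  then show ?case using bounded_bilinear.continuous_on[OF assms] by auto
next
  case (Suc k)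
  obtain f' where f': "\<And>x. x \<in> U \<Longrightarrow> (f has_derivative f' x) (at x)" "\<And>v. Ck_on k (\<lambda>x. f' x v) U"
    using Suc.prems(1) by (rule Ck_on_SucE) blast
  obtain g' where g': "\<And>x. x \<in> U \<Longrightarrow> (g has_derivative g' x) (at x)" "\<And>v. Ck_on k (\<lambda>x. g' x v) U"
    using Suc.prems(2) by (rule Ck_on_SucE) blast
  show ?case
    by (rule Ck_on_SucI[where f' = "\<lambda>x v. mul (f x) (g' x v) + mul (f' x v) (g x)"])
       (auto intro!: bounded_bilinear.FDERIV[OF assms] Ck_on_add f' g' Suc.IH
         Ck_on_SucD[OF Suc.prems(1)] Ck_on_SucD[OF Suc.prems(2)])
qed

lemmas Ck_on_scaleR = Ck_on_bilinear[OF bounded_bilinear_scaleR]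
lemmas Ck_on_mult = Ck_on_bilinear[OF bounded_bilinear_mult]
lemmas Ck_on_inner = Ck_on_bilinear[OF bounded_bilinear_inner]

text \<open>
  The shape in which derivatives of composite maps arise: an operator depending on the point,
  applied to a vector depending on the point. Expanding the vector in the standard basis
  reduces this to products of scalar coordinates with the vectors \<open>A\<^sub>x b\<close>.
\<close>

lemma Ck_on_linear_family:
  assumes A: "\<And>x. x \<in> U \<Longrightarrow> linear (A x)" and U: "open U"
    and Ab: "\<And>b. b \<in> Basis \<Longrightarrow> Ck_on k (\<lambda>x. A x b) U" and h: "Ck_on k h U"
  shows "Ck_on k (\<lambda>x. A x (h x)) U"
proof (rule Ck_on_cong[OF U])
  show "Ck_on k (\<lambda>x. \<Sum>b\<in>Basis. (h x \<bullet> b) *\<^sub>R A x b) U"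
    by (intro Ck_on_sum Ck_on_scaleR Ck_on_inner Ab h Ck_on_const)
  fix x assume "x \<in> U"
  then have l: "linear (A x)" by (rule A)
  have "A x (\<Sum>b\<in>Basis. (h x \<bullet> b) *\<^sub>R b) = (\<Sum>b\<in>Basis. (h x \<bullet> b) *\<^sub>R A x b)"
    by (simp add: linear_sum[OF l] linear_scale[OF l])
  then show "A x (h x) = (\<Sum>b\<in>Basis. (h x \<bullet> b) *\<^sub>R A x b)"
    by (simp add: euclidean_representation)
qed

lemma Ck_on_compose:
  assumes U: "open U"
  shows "Ck_on k f U \<Longrightarrow> Ck_on k g V \<Longrightarrow> f ` U \<subseteq> V \<Longrightarrow> Ck_on k (\<lambda>x. g (f x)) U"
proof (induction k arbitrary: g)
  case 0
  then show ?case by (auto intro: continuous_on_compose2)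
next
  case (Suc k)
  obtain f' where f': "\<And>x. x \<in> U \<Longrightarrow> (f has_derivative f' x) (at x)" "\<And>v. Ck_on k (\<lambda>x. f' x v) U"
    using Suc.prems(1) by (rule Ck_on_SucE) blast
  obtain g' where g': "\<And>x. x \<in> V \<Longrightarrow> (g has_derivative g' x) (at x)" "\<And>v. Ck_on k (\<lambda>x. g' x v) V"
    using Suc.prems(2) by (rule Ck_on_SucE) blast
  show ?case
  proof (rule Ck_on_SucI[where f' = "\<lambda>x v. g' (f x) (f' x v)"])
    fix x assume "x \<in> U"
    then show "((\<lambda>x. g (f x)) has_derivative (\<lambda>v. g' (f x) (f' x v))) (at x)"
      using Suc.prems(3) f'(1) g'(1) by (intro has_derivative_compose[where f=f and g=g]) auto
  next
    fix v
    show "Ck_on k (\<lambda>x. g' (f x) (f' x v)) U"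
    proof (rule Ck_on_linear_family[where A = "\<lambda>x. g' (f x)" and h = "\<lambda>x. f' x v"])
      show "linear (g' (f x))" if "x \<in> U" for x
        using that g'(1) Suc.prems(3) has_derivative_linear by blast
      show "Ck_on k (\<lambda>x. g' (f x) b) U" for b
        using Suc.IH[OF Ck_on_SucD[OF Suc.prems(1)] g'(2) Suc.prems(3)] .
    qed (use U f' in auto)
  qed
qed

lemma Ck_on_inverse: "Ck_on k (inverse :: real \<Rightarrow> real) (- {0})"
proof (induction k)
  case 0
  then show ?case by (auto intro: continuous_intros)
next
  case (Suc k)
  show ?case
    by (intro Ck_on_SucI[where f' = "\<lambda>x v. - 1 * (inverse x * v * inverse x)"]
        Ck_on_mult Suc.IH Ck_on_const)
       (auto intro!: derivative_eq_intros)
qed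

lemma Ck_on_sqrt: "Ck_on k sqrt {0<..}"
proof (induction k)
  case 0
  then show ?case by (auto intro: continuous_intros)
next
  case (Suc k)
  have "Ck_on k (\<lambda>x. inverse (sqrt x)) {0<..}"
    by (rule Ck_on_compose[OF _ Suc.IH Ck_on_inverse]) auto
  then show ?case
    by (intro Ck_on_SucI[where f' = "\<lambda>x v. v * (inverse (sqrt x) * (1/2))"] Ck_on_mult Ck_on_const)
       (auto intro!: derivative_eq_intros simp: field_simps)
qed

lemma Ck_on_norm: "Ck_on k norm (- {0 :: 'a::euclidean_space})"
proof -
  have "Ck_on k (\<lambda>x::'a. sqrt (x \<bullet> x)) (- {0})"
    by (rule Ck_on_compose[OF _ _ Ck_on_sqrt]) (auto intro!: Ck_on_inner Ck_on_linear[OF linear_ident])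
  then show ?thesis by (simp add: norm_eq_sqrt_inner[abs_def])
qed

text \<open>
  At a zero of \<open>f\<close> the term \<open>f \<cdot> g'\<close> of the product rule drops out, and continuity of \<open>g\<close>
  takes its place. This breaks the circle when the derivative of a family of inverses is
  computed from expressions which contain these inverses themselves.
\<close>

lemma has_derivative_scaleR_vanishing:
  fixes f :: "'a::real_normed_vector \<Rightarrow> real" and g :: "'a \<Rightarrow> 'b::real_normed_vector"
  assumes f: "(f has_derivative f') (at x)" "f x = 0" and g: "isCont g x"
  shows "((\<lambda>y. f y *\<^sub>R g y) has_derivative (\<lambda>h. f' h *\<^sub>R g x)) (at x)"
proof -
  have bl: "bounded_linear f'" using f(1) has_derivative_bounded_linear by blast
  obtain K where K: "\<And>h. norm (f' h) \<le> norm h * K" using bl bounded_linear.bounded by blast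
  define R where "R y = (f y - f' (y - x)) / norm (y - x)" for y
  have R: "(R \<longlongrightarrow> 0) (at x)"
    using f unfolding R_def has_derivative_iff_norm
    by (subst tendsto_norm_zero_iff[symmetric]) simp
  have g0: "((\<lambda>y. g y - g x) \<longlongrightarrow> 0) (at x)" using g by (simp add: isCont_def LIM_zero)
  have *: "(f y *\<^sub>R g y - f x *\<^sub>R g x - f' (y - x) *\<^sub>R g x) /\<^sub>R norm (y - x)
      = R y *\<^sub>R g y + (f' (y - x) / norm (y - x)) *\<^sub>R (g y - g x)" for y
    using f(2) by (simp add: R_def algebra_simps divide_inverse)
  have "\<forall>\<^sub>F y in at x. norm ((f' (y - x) / norm (y - x)) *\<^sub>R (g y - g x)) \<le> K * norm (g y - g x)"
  proof (rule eventually_at_topological[THEN iffD2], intro exI[of _ UNIV] conjI ballI impI)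
    fix y assume "y \<noteq> x"
    then have "\<bar>f' (y - x)\<bar> / norm (y - x) \<le> K"
      using K[of "y - x"] by (simp add: pos_divide_le_eq mult.commute)
    then show "norm ((f' (y - x) / norm (y - x)) *\<^sub>R (g y - g x)) \<le> K * norm (g y - g x)"
      using mult_right_mono[of _ K "norm (g y - g x)"] by fastforce
  qed auto
  moreover have "((\<lambda>y. K * norm (g y - g x)) \<longlongrightarrow> 0) (at x)"
    using tendsto_mult_right_zero[OF tendsto_norm_zero[OF g0]] .
  ultimately have B: "((\<lambda>y. (f' (y - x) / norm (y - x)) *\<^sub>R (g y - g x)) \<longlongrightarrow> 0) (at x)"
    by (rule Lim_null_comparison)
  have "((\<lambda>y. R y *\<^sub>R g y) \<longlongrightarrow> 0) (at x)"
    using tendsto_scaleR[OF R g[unfolded isCont_def]] by simp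
  from tendsto_add[OF this B]
  have "((\<lambda>y. R y *\<^sub>R g y + (f' (y - x) / norm (y - x)) *\<^sub>R (g y - g x)) \<longlongrightarrow> 0) (at x)"
    by simp
  then show ?thesis
    unfolding has_derivative_at_within
    using bounded_linear_compose[OF bounded_linear_scaleR_left bl] by (simp only: * simp_thms)
qed

section \<open>Inverses of families of operators\<close>

lemma linear_inv_bij:
  assumes "linear f" "bij f" shows "linear (inv f)"
proof (rule linearI)
  have f: "f (inv f x) = x" for x using assms(2) by (simp add: bij_is_surj surj_f_inv_f)
  show "inv f (x + y) = inv f x + inv f y" for x y
    by (rule inv_f_eq[OF bij_is_inj[OF assms(2)]]) (simp add: linear_add[OF assms(1)] f)
  show "inv f (c *\<^sub>R x) = c *\<^sub>R inv f x" for c x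
    by (rule inv_f_eq[OF bij_is_inj[OF assms(2)]]) (simp add: linear_scale[OF assms(1)] f)
qed

text \<open>
  With \<open>w = A\<^sub>p\<^sup>-\<^sup>1 v\<close>, the identity \<open>A\<^sub>x (A\<^sub>x\<^sup>-\<^sup>1 v - w) = v - A\<^sub>x w\<close> has a right-hand side tending to
  \<open>0\<close> as \<open>x\<close> tends to \<open>p\<close>. The left-hand side controls \<open>A\<^sub>x\<^sup>-\<^sup>1 v - w\<close> because the lower bound
  \<open>m \<parallel>u\<parallel> \<le> \<parallel>A\<^sub>p u\<parallel>\<close> persists near \<open>p\<close> with \<open>m / 2\<close> in place of \<open>m\<close>.
\<close>

lemma continuous_on_inv_family:
  fixes A :: "'a::euclidean_space \<Rightarrow> 'b::euclidean_space \<Rightarrow> 'c::euclidean_space"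
  assumes lin: "\<And>x. x \<in> U \<Longrightarrow> linear (A x)" and bij: "\<And>x. x \<in> U \<Longrightarrow> bij (A x)" and U: "open U"
    and cont: "\<And>u. continuous_on U (\<lambda>x. A x u)"
  shows "continuous_on U (\<lambda>x. inv (A x) v)"
proof -
  have "((\<lambda>x. inv (A x) v) \<longlongrightarrow> inv (A p) v) (at p)" if p: "p \<in> U" for p
  proof -
    define w where "w = inv (A p) v"
    have Aw: "A p w = v" using bij[OF p] by (simp add: w_def bij_is_surj surj_f_inv_f)
    obtain m where m: "m > 0" "\<And>u. m * norm u \<le> norm (A p u)"
      using linear_inj_bounded_below_pos[OF lin[OF p] bij_is_inj[OF bij[OF p]]] by blast
    define D where "D x = (\<Sum>b\<in>Basis. norm (A x b - A p b))" for x
    have tends: "((\<lambda>x. A x u) \<longlongrightarrow> A p u) (at p)" for u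
      using cont U p by (metis continuous_on_eq_continuous_at isCont_def)
    have "(D \<longlongrightarrow> (\<Sum>b\<in>(Basis::'b set). norm (A p b - A p b))) (at p)"
      unfolding D_def by (intro tendsto_intros tends)
    then have "(D \<longlongrightarrow> 0) (at p)" by simp
    then have D: "\<forall>\<^sub>F x in at p. D x < m / 2" using m by (intro order_tendstoD) auto
    have inU: "\<forall>\<^sub>F x in at p. x \<in> U" using U p by (simp add: eventually_at_in_open')
    have "\<forall>\<^sub>F x in at p. norm (inv (A x) v - w) \<le> (2 / m) * norm (v - A x w)"
      using D inU
    proof eventually_elim
      case (elim x)
      let ?u = "inv (A x) v - w"
      have lx: "linear (A x)" and lp: "linear (A p)" using lin elim p by auto
      have "A x ?u - A p ?u = (\<Sum>b\<in>Basis. (?u \<bullet> b) *\<^sub>R (A x b - A p b))"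
      proof -
        have "A x ?u - A p ?u = (\<lambda>u. A x u - A p u) (\<Sum>b\<in>Basis. (?u \<bullet> b) *\<^sub>R b)"
          by (simp only: euclidean_representation)
        also have "\<dots> = (\<Sum>b\<in>Basis. (?u \<bullet> b) *\<^sub>R (A x b - A p b))"
          by (simp only: linear_sum[OF lx] linear_sum[OF lp] linear_scale[OF lx] linear_scale[OF lp]
              scaleR_diff_right sum_subtractf)
        finally show ?thesis .
      qed
      also have "norm \<dots> \<le> (\<Sum>b\<in>Basis. norm ?u * norm (A x b - A p b))"
        by (rule sum_norm_le) (auto intro!: mult_right_mono Basis_le_norm)
      also have "\<dots> = norm ?u * D x" by (simp add: D_def sum_distrib_left)
      also have "\<dots> \<le> norm ?u * (m / 2)" using elim by (intro mult_left_mono) auto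
      finally have "norm (A x ?u) \<ge> norm (A p ?u) - norm ?u * (m / 2)"
        using norm_triangle_ineq2[of "A p ?u" "A x ?u"] by (simp add: norm_minus_commute)
      with m(2)[of ?u] have "norm ?u * (m / 2) \<le> norm (A x ?u)" by (simp add: algebra_simps)
      moreover have "A x ?u = v - A x w"
        using bij[OF elim(2)] by (simp add: linear_diff[OF lx] bij_is_surj surj_f_inv_f)
      ultimately show ?case using m(1) by (simp add: field_simps)
    qed
    moreover have "((\<lambda>x. (2 / m) * norm (v - A x w)) \<longlongrightarrow> 0) (at p)"
    proof -
      have "((\<lambda>x. (2 / m) * norm (v - A x w)) \<longlongrightarrow> (2 / m) * norm (v - A p w)) (at p)"
        by (intro tendsto_intros tends)
      then show ?thesis by (simp add: Aw)
    qed
    ultimately have "((\<lambda>x. inv (A x) v - w) \<longlongrightarrow> 0) (at p)" by (rule Lim_null_comparison)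
    then show ?thesis by (simp add: w_def LIM_zero_iff)
  qed
  then show ?thesis by (meson continuous_at_imp_continuous_on isCont_def)
qed

text \<open>
  The formula \<open>(A\<^sup>-\<^sup>1)' = - A\<^sup>-\<^sup>1 A' A\<^sup>-\<^sup>1\<close>. It follows from
  \<open>A\<^sub>x\<^sup>-\<^sup>1 v = w - \<Sum>\<^sub>c \<langle>A\<^sub>x w - v, c\<rangle> A\<^sub>x\<^sup>-\<^sup>1 c\<close> with \<open>w = A\<^sub>p\<^sup>-\<^sup>1 v\<close>, since every
  scalar coefficient vanishes at \<open>p\<close> and the vectors \<open>A\<^sub>x\<^sup>-\<^sup>1 c\<close> are continuous.
\<close>

lemma has_derivative_inv_family:
  fixes A :: "'a::euclidean_space \<Rightarrow> 'b::euclidean_space \<Rightarrow> 'c::euclidean_space"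
  assumes lin: "\<And>x. x \<in> U \<Longrightarrow> linear (A x)" and bij: "\<And>x. x \<in> U \<Longrightarrow> bij (A x)" and U: "open U"
    and cont: "\<And>u. continuous_on U (\<lambda>x. A x u)" and p: "p \<in> U"
    and der: "((\<lambda>x. A x (inv (A p) v)) has_derivative D) (at p)"
  shows "((\<lambda>x. inv (A x) v) has_derivative (\<lambda>h. - inv (A p) (D h))) (at p)"
proof -
  define w where "w = inv (A p) v"
  have Aw: "A p w = v" using bij[OF p] by (simp add: w_def bij_is_surj surj_f_inv_f)
  have linv: "linear (inv (A x))" if "x \<in> U" for x
    using that lin bij linear_inv_bij by blast
  have expand: "inv (A x) z = (\<Sum>c\<in>Basis. (z \<bullet> c) *\<^sub>R inv (A x) c)" if "x \<in> U" for x z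
  proof -
    have "inv (A x) z = inv (A x) (\<Sum>c\<in>Basis. (z \<bullet> c) *\<^sub>R c)" by (simp only: euclidean_representation)
    then show ?thesis by (simp only: linear_sum[OF linv[OF that]] linear_scale[OF linv[OF that]])
  qed
  have cinv: "isCont (\<lambda>x. inv (A x) c) p" for c
    using continuous_on_inv_family[OF lin bij U cont] U p continuous_on_eq_continuous_at by blast
  have d: "((\<lambda>x. (A x w - v) \<bullet> c) has_derivative (\<lambda>h. D h \<bullet> c)) (at p)" for c
    using der unfolding w_def[symmetric] by (auto intro!: derivative_eq_intros)
  have "((\<lambda>x. w - (\<Sum>c\<in>Basis. ((A x w - v) \<bullet> c) *\<^sub>R inv (A x) c))
      has_derivative (\<lambda>h. 0 - (\<Sum>c\<in>Basis. (D h \<bullet> c) *\<^sub>R inv (A p) c))) (at p)"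
    by (intro has_derivative_diff has_derivative_const has_derivative_sum
        has_derivative_scaleR_vanishing d cinv) (simp add: Aw)
  then have "((\<lambda>x. w - (\<Sum>c\<in>Basis. ((A x w - v) \<bullet> c) *\<^sub>R inv (A x) c))
      has_derivative (\<lambda>h. - inv (A p) (D h))) (at p)"
    by (simp add: expand[OF p, symmetric])
  then show ?thesis
  proof (rule has_derivative_transform_within_open[OF _ U p])
    fix x assume x: "x \<in> U"
    have "inv (A x) (A x w - v) = w - inv (A x) v"
      using bij[OF x] by (simp add: linear_diff[OF linv[OF x]] bij_is_inj)
    then show "w - (\<Sum>c\<in>Basis. ((A x w - v) \<bullet> c) *\<^sub>R inv (A x) c) = inv (A x) v"
      by (simp add: expand[OF x, symmetric])
  qed
qed

text \<open>
  Inversion of operators preserves the class \<open>C\<^sup>k\<close>: the derivative \<open>- A\<^sup>-\<^sup>1 A' A\<^sup>-\<^sup>1 v\<close> is built from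
  inverses one differentiability class lower, which makes an induction on \<open>k\<close> work.
\<close>

lemma Ck_on_inv_family:
  fixes A :: "'a::euclidean_space \<Rightarrow> 'b::euclidean_space \<Rightarrow> 'c::euclidean_space"
  assumes lin: "\<And>x. x \<in> U \<Longrightarrow> linear (A x)" and bij: "\<And>x. x \<in> U \<Longrightarrow> bij (A x)" and U: "open U"
  shows "(\<And>u. Ck_on k (\<lambda>x. A x u) U) \<Longrightarrow> Ck_on k (\<lambda>x. inv (A x) v) U"
proof (induction k arbitrary: v)
  case 0
  then show ?case using continuous_on_inv_family[OF lin bij U] by simp
next
  case (Suc k)
  have "\<exists>A'. (\<forall>x\<in>U. ((\<lambda>x. A x u) has_derivative A' x) (at x)) \<and> (\<forall>h. Ck_on k (\<lambda>x. A' x h) U)" for u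
    using Suc.prems[of u] by (simp add: Ck_on.simps(2))
  then obtain A' where A': "\<And>u x. x \<in> U \<Longrightarrow> ((\<lambda>x. A x u) has_derivative A' u x) (at x)"
      "\<And>u h. Ck_on k (\<lambda>x. A' u x h) U"
    by metis
  have IH: "Ck_on k (\<lambda>x. inv (A x) u) U" for u using Suc Ck_on_SucD by blast
  have linv: "linear (inv (A x))" if "x \<in> U" for x
    using that lin bij linear_inv_bij by blast
  define D where "D x h = (\<Sum>b\<in>Basis. (inv (A x) v \<bullet> b) *\<^sub>R A' b x h)" for x h
  show ?case
  proof (rule Ck_on_SucI[where f' = "\<lambda>x h. inv (A x) (- 1 *\<^sub>R D x h)"])
    fix x assume x: "x \<in> U"
    have "((\<lambda>y. \<Sum>b\<in>Basis. (inv (A x) v \<bullet> b) *\<^sub>R A y b) has_derivative D x) (at x)"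
      unfolding D_def by (intro has_derivative_sum has_derivative_scaleR_right A' x)
    then have "((\<lambda>y. A y (inv (A x) v)) has_derivative D x) (at x)"
    proof (rule has_derivative_transform_within_open[OF _ U x])
      fix y assume "y \<in> U"
      then have l: "linear (A y)" by (rule lin)
      have "A y (inv (A x) v) = A y (\<Sum>b\<in>Basis. (inv (A x) v \<bullet> b) *\<^sub>R b)"
        by (simp only: euclidean_representation)
      then show "(\<Sum>b\<in>Basis. (inv (A x) v \<bullet> b) *\<^sub>R A y b) = A y (inv (A x) v)"
        by (simp only: linear_sum[OF l] linear_scale[OF l])
    qed
    moreover have "continuous_on U (\<lambda>x. A x u)" for u
      using Suc.prems by (rule Ck_on_continuous)
    ultimately have "((\<lambda>x. inv (A x) v) has_derivative (\<lambda>h. - inv (A x) (D x h))) (at x)"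
      by (intro has_derivative_inv_family[OF lin bij U _ x])
    then show "((\<lambda>x. inv (A x) v) has_derivative (\<lambda>h. inv (A x) (- 1 *\<^sub>R D x h))) (at x)"
      by (simp add: linear_neg[OF linv[OF x]])
  next
    fix h
    show "Ck_on k (\<lambda>x. inv (A x) (- 1 *\<^sub>R D x h)) U"
    proof (rule Ck_on_linear_family[where A = "\<lambda>x. inv (A x)"])
      show "Ck_on k (\<lambda>x. - 1 *\<^sub>R D x h) U"
        unfolding D_def by (intro IH Ck_on_scaleR Ck_on_const Ck_on_sum Ck_on_inner A')
    qed (use U linv IH in auto)
  qed
qed

section \<open>Local inverses and regular level sets\<close>

lemma Ck_on_derivative:
  assumes "open U" "Ck_on (Suc k) f U" "\<And>x. x \<in> U \<Longrightarrow> (f has_derivative f' x) (at x)"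
  shows "Ck_on k (\<lambda>x. f' x v) U"
proof -
  obtain g where g: "\<And>x. x \<in> U \<Longrightarrow> (f has_derivative g x) (at x)" "\<And>v. Ck_on k (\<lambda>x. g x v) U"
    using assms(2) by (rule Ck_on_SucE) blast
  have "f' x = g x" if "x \<in> U" for x
    using assms(3)[OF that] g(1)[OF that] by (rule has_derivative_unique)
  then show ?thesis
    by (intro Ck_on_cong[OF assms(1) g(2)]) simp
qed

text \<open>
  The inverse function theorem yields a differentiable local inverse \<open>g\<close> with
  \<open>g' y = (f' (g y))\<^sup>-\<^sup>1\<close>. If \<open>g\<close> is of class \<open>C\<^sup>k\<close> then so is the right-hand side, hence
  \<open>g\<close> is of class \<open>C\<^sup>k\<^sup>+\<^sup>1\<close>.
\<close>

theorem smooth_inverse_function: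
  fixes f :: "'a::euclidean_space \<Rightarrow> 'a"
  assumes U: "open U" "p \<in> U" and f: "\<And>k. Ck_on k f U"
    and der: "(f has_derivative f0) (at p)" and inj: "inj f0"
  obtains U' V g where "open U'" "U' \<subseteq> U" "p \<in> U'" "open V" "homeomorphism U' V f g"
    "\<And>k. Ck_on k g V"
proof -
  obtain f' where f': "\<And>x. x \<in> U \<Longrightarrow> (f has_derivative f' x) (at x)"
    using f[of "Suc 0"] by (rule Ck_on_SucE) blast
  have Ck': "Ck_on k (\<lambda>x. f' x v) U" for k v
    by (rule Ck_on_derivative[OF U(1) f f'])
  have bl: "bounded_linear (f' x)" if "x \<in> U" for x
    using f'[OF that] has_derivative_bounded_linear by blast
  define F where "F x = Blinfun (f' x)" for x
  have F: "blinfun_apply (F x) = f' x" if "x \<in> U" for x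
    using bl[OF that] by (simp add: F_def bounded_linear_Blinfun_apply)
  have f0: "f' p = f0" using der f' U has_derivative_unique by blast
  have "linear f0" using der has_derivative_linear by blast
  then obtain h where h: "linear h" "h \<circ> f0 = id"
    using linear_injective_left_inverse inj by blast
  have derF: "(f has_derivative blinfun_apply (F x)) (at x)" if "x \<in> U" for x
    using that f' F by metis
  have contF: "continuous_on U F"
  proof (rule continuous_on_blinfun_componentwise)
    fix i :: 'a
    show "continuous_on U (\<lambda>x. blinfun_apply (F x) i)"
      using Ck'[of 0 i] F by (auto cong: continuous_on_cong)
  qed
  have invF: "Blinfun h o\<^sub>L F p = id_blinfun"
    using h f0 F[OF U(2)] linear_conv_bounded_linear[THEN iffD1, OF h(1)]
    by (intro blinfun_eqI) (simp add: bounded_linear_Blinfun_apply pointfree_idE)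
  obtain U' V g g' where *: "open U'" "U' \<subseteq> U" "p \<in> U'" "open V" "f p \<in> V" "homeomorphism U' V f g"
    "\<And>y. y \<in> V \<Longrightarrow> (g has_derivative (g' y)) (at y)"
    "\<And>y. y \<in> V \<Longrightarrow> g' y = inv (blinfun_apply (F (g y)))"
    "\<And>y. y \<in> V \<Longrightarrow> bij (blinfun_apply (F (g y)))"
    by (rule inverse_function_theorem[OF U(1) derF contF U(2) invF]) blast+
  have gU: "g y \<in> U" if "y \<in> V" for y
    using that * homeomorphism_image2 by blast
  have "Ck_on k g V" for k
  proof (induction k)
    case 0
    then show ?case using *(6) by (simp add: homeomorphism_cont2)
  next
    case (Suc k)
    show ?case
    proof (rule Ck_on_SucI[where f' = "\<lambda>y. inv (f' (g y))"])
      show "(g has_derivative inv (f' (g y))) (at y)" if "y \<in> V" for y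
        using that *(7,8) F gU by metis
      show "Ck_on k (\<lambda>y. inv (f' (g y)) v) V" for v
      proof (rule Ck_on_inv_family)
        show "linear (f' (g y))" if "y \<in> V" for y
          using bl[OF gU[OF that]] bounded_linear.linear by blast
        show "bij (f' (g y))" if "y \<in> V" for y
          using that *(9) F gU by metis
        show "Ck_on k (\<lambda>y. f' (g y) u) V" for u
          by (rule Ck_on_compose[OF *(4) Suc Ck']) (use gU in auto)
      qed (rule *(4))
    qed
  qed
  with * that show ?thesis by blast
qed

text \<open>
  The kernel of \<open>F\<close> is the orthogonal complement of the range of the adjoint, and the adjoint
  is injective because \<open>F\<close> is surjective.
\<close>

lemma dim_kernel_surjective:
  fixes F :: "'a::euclidean_space \<Rightarrow> 'b::euclidean_space"
  assumes "linear F" "surj F"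
  shows "dim {x. F x = 0} + DIM('b) = DIM('a)"
proof -
  let ?R = "range (adjoint F)"
  have inj: "inj (adjoint F)"
  proof (rule injI)
    fix y z assume "adjoint F y = adjoint F z"
    then have "F x \<bullet> y = F x \<bullet> z" for x using adjoint_works[OF assms(1)] by metis
    then have "x \<bullet> y = x \<bullet> z" for x using assms(2) by (metis surj_def)
    then have "\<forall>x. x \<bullet> y = x \<bullet> z" ..
    then show "y = z" by (rule vector_eq_ldot[THEN iffD1])
  qed
  have lin: "linear (adjoint F)" using adjoint_linear assms(1) by blast
  have "dim ?R = DIM('b)"
    using dim_image_eq[OF lin, of UNIV] inj by simp
  moreover have "orthogonal (adjoint F y) x \<longleftrightarrow> F x \<bullet> y = 0" for x y
    by (simp add: orthogonal_def inner_commute[of "adjoint F y"] adjoint_works[OF assms(1)])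
  then have "{x. F x = 0} = {y \<in> UNIV. \<forall>x\<in>?R. orthogonal x y}"
    by (auto dest: spec[where x = "F _"])
  ultimately show ?thesis
    using dim_subspace_orthogonal_to_vectors[OF _ subspace_UNIV, of ?R] lin
    by (simp add: linear_subspace_image)
qed

lemma smooth_map_open:
  assumes "open U" "\<And>k. Ck_on k f U" "A \<subseteq> U" shows "smooth_map A f"
  using assms unfolding smooth_map_def by blast

text \<open>
  Let \<open>A\<close> be the derivative of \<open>F\<close> at a point \<open>p\<close> of the level set and \<open>L\<close> a linear right inverse
  of \<open>A\<close>. The map \<open>\<phi> x = (x - p) - L (A (x - p)) + L (F x - c)\<close> has the identity as derivative at
  \<open>p\<close>, so it is a local diffeomorphism. Moreover \<open>A (\<phi> x) = F x - c\<close>: it carries the level set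
  exactly to the kernel of \<open>A\<close>.
\<close>

theorem regular_level_set_submanifold:
  fixes F :: "'a::euclidean_space \<Rightarrow> 'b::euclidean_space"
  assumes codim: "d + DIM('b) = DIM('a)" and U: "open U" and F: "\<And>k. Ck_on k F U"
    and der: "\<And>p. p \<in> U \<Longrightarrow> F p = c \<Longrightarrow> (F has_derivative F' p) (at p)"
    and surj: "\<And>p. p \<in> U \<Longrightarrow> F p = c \<Longrightarrow> surj (F' p)"
  shows "embedded_submanifold d {x \<in> U. F x = c}"
  unfolding embedded_submanifold_def
proof
  let ?M = "{x \<in> U. F x = c}"
  fix p assume "p \<in> ?M"
  then have p: "p \<in> U" "F p = c" by auto
  define A where "A = F' p"
  have derA: "(F has_derivative A) (at p)" and surjA: "surj A"
    using der surj p by (auto simp: A_def)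
  have lF: "linear A" using derA has_derivative_linear by blast
  obtain L where L: "linear L" "A \<circ> L = id"
    using linear_surjective_right_inverse lF surjA by blast
  have FL: "A (L y) = y" for y using L(2) by (simp add: pointfree_idE)
  \<comment> \<open>Differences are spelled as sums with multiples by \<open>-1\<close>, the form in which
    smoothness is read off from \<open>Ck_on_add\<close> and \<open>Ck_on_scaleR\<close>.\<close>
  define \<phi> where "\<phi> x = x + (- 1 *\<^sub>R p + (L (- 1 *\<^sub>R A (x + - 1 *\<^sub>R p)) + L (F x + - 1 *\<^sub>R c)))" for x
  have Ck\<phi>: "Ck_on k \<phi> U" for k
    unfolding \<phi>_def
    by (intro Ck_on_add Ck_on_const Ck_on_linear[OF linear_ident] F Ck_on_scaleR
        Ck_on_compose[OF U _ Ck_on_linear[OF L(1), of _ UNIV]]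
        Ck_on_compose[OF U _ Ck_on_linear[OF lF, of _ UNIV]]) auto
  have der\<phi>: "(\<phi> has_derivative (\<lambda>h. h)) (at p)"
  proof -
    have bL: "bounded_linear L" and bF: "bounded_linear A"
      using L lF linear_conv_bounded_linear by auto
    have "(\<phi> has_derivative (\<lambda>h. h + (0 + (L (- 1 *\<^sub>R A (h + 0)) + L (A h + 0))))) (at p)"
      unfolding \<phi>_def
      by (intro has_derivative_add has_derivative_ident has_derivative_const
          bounded_linear.has_derivative[OF bL] bounded_linear.has_derivative[OF bF]
          has_derivative_scaleR_right derA)
    then show ?thesis by (simp add: linear_neg[OF L(1)])
  qed
  obtain U' V \<psi> where *: "open U'" "U' \<subseteq> U" "p \<in> U'" "open V" "homeomorphism U' V \<phi> \<psi>"
    "\<And>k. Ck_on k \<psi> V"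
    using smooth_inverse_function[OF U p(1) Ck\<phi> der\<phi>] by auto
  have "diffeomorphism U' V \<phi> \<psi>"
    unfolding diffeomorphism_def
    using * smooth_map_open[OF *(4,6)] smooth_map_open[OF U Ck\<phi> *(2)]
    by (auto simp: homeomorphism_def)
  moreover have "\<phi> ` (?M \<inter> U') = {x. A x = 0} \<inter> V"
  proof -
    have "A (\<phi> x) = F x - c" for x
      by (simp add: \<phi>_def linear_add[OF lF] linear_neg[OF lF] linear_neg[OF L(1)] FL linear_diff[OF lF])
    then have "x \<in> ?M \<longleftrightarrow> A (\<phi> x) = 0" if "x \<in> U'" for x
      using that *(2) by auto
    then show ?thesis using *(5) by (fastforce simp: homeomorphism_def)
  qed
  moreover have "subspace {x. A x = 0}" using lF by (rule linear_subspace_kernel)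
  moreover have "dim {x. A x = 0} = d" using dim_kernel_surjective[OF lF surjA] codim by simp
  ultimately have "open U' \<and> p \<in> U' \<and> open V \<and> diffeomorphism U' V \<phi> \<psi> \<and>
      subspace {x. A x = 0} \<and> dim {x. A x = 0} = d \<and> \<phi> ` (?M \<inter> U') = {x. A x = 0} \<inter> V"
    using *(1,3,4) by simp
  then show "\<exists>U V E (\<phi> :: 'a \<Rightarrow> 'a) \<psi>. open U \<and> p \<in> U \<and> open V \<and> diffeomorphism U V \<phi> \<psi> \<and>
      subspace E \<and> dim E = d \<and> \<phi> ` (?M \<inter> U) = E \<inter> V"
    by - (intro exI, assumption)
qed

section \<open>Identities for octonions\<close>

lemma oct_cases:
  fixes x :: oct
  obtains a b c d e f g h where "x = ((a, b, c, d), (e, f, g, h))"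
  by (metis prod.exhaust)

text \<open>
  Multiplication by a fixed octonion is a similarity, with factor the norm. Here
  \<open>\<parallel>x z\<parallel>\<^sup>2 = \<parallel>x\<parallel>\<^sup>2 \<parallel>z\<parallel>\<^sup>2\<close>, Degen's eight-square identity, is polarised in either factor; like the other identities
  of this section they are polynomial identities in the coordinates.
\<close>

lemma oct_mult_inner_right:
  "oct_mult x z \<bullet> oct_mult y z = (x \<bullet> y) * (z \<bullet> z)"
  by (cases x rule: oct_cases; cases y rule: oct_cases; cases z rule: oct_cases) (simp add: algebra_simps)

lemma oct_mult_inner_left:
  "oct_mult z x \<bullet> oct_mult z y = (z \<bullet> z) * (x \<bullet> y)"
  by (cases x rule: oct_cases; cases y rule: oct_cases; cases z rule: oct_cases) (simp add: algebra_simps)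

lemma oct_mult_adjoint_left:
  "oct_mult x y \<bullet> z = y \<bullet> oct_mult (oct_cnj x) z"
  by (cases x rule: oct_cases; cases y rule: oct_cases; cases z rule: oct_cases) (simp add: algebra_simps)

lemma oct_mult_adjoint_right:
  "oct_mult x y \<bullet> z = x \<bullet> oct_mult z (oct_cnj y)"
  by (cases x rule: oct_cases; cases y rule: oct_cases; cases z rule: oct_cases) (simp add: algebra_simps)

lemma oct_flexible:
  "oct_mult (oct_mult x y) x = oct_mult x (oct_mult y x)"
  by (cases x rule: oct_cases; cases y rule: oct_cases) (simp add: algebra_simps)

lemma oct_cnj_mult:
  "oct_cnj (oct_mult x y) = oct_mult (oct_cnj y) (oct_cnj x)"
  by (cases x rule: oct_cases; cases y rule: oct_cases) (simp add: algebra_simps)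

lemma oct_cnj_cnj [simp]:
  "oct_cnj (oct_cnj x) = x"
  by (cases x rule: oct_cases) (simp add: algebra_simps)

lemma oct_inner_cnj:
  "oct_cnj x \<bullet> y = x \<bullet> oct_cnj y"
  by (cases x rule: oct_cases; cases y rule: oct_cases) (simp add: algebra_simps)

lemma oct_mult_inner_self_left:
  "oct_mult x y \<bullet> y = fst (fst x) * (y \<bullet> y)"
  by (cases x rule: oct_cases; cases y rule: oct_cases) (simp add: algebra_simps)

lemma oct_mult_inner_self_right:
  "oct_mult y x \<bullet> y = fst (fst x) * (y \<bullet> y)"
  by (cases x rule: oct_cases; cases y rule: oct_cases) (simp add: algebra_simps)

lemma oct_mult_cnj_cancel_left:
  "oct_mult x (oct_mult (oct_cnj x) y) = (x \<bullet> x) *\<^sub>R y"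
  by (cases x rule: oct_cases; cases y rule: oct_cases) (simp add: algebra_simps)

lemma oct_mult_cnj_cancel_right:
  "oct_mult (oct_mult y (oct_cnj x)) x = (x \<bullet> x) *\<^sub>R y"
  by (cases x rule: oct_cases; cases y rule: oct_cases) (simp add: algebra_simps)

lemma oct_mult_minus_left:
  "oct_mult (- x) y = - oct_mult x y"
  by (cases x rule: oct_cases; cases y rule: oct_cases) (simp add: algebra_simps)

lemma oct_mult_minus_right:
  "oct_mult x (- y) = - oct_mult x y"
  by (cases x rule: oct_cases; cases y rule: oct_cases) (simp add: algebra_simps)

lemma Re_oct_mult_imag:
  assumes "fst (fst x) = 0" "fst (fst y) = 0"
  shows "fst (fst (oct_mult x y)) = - (x \<bullet> y)"
  using assms by (cases x rule: oct_cases; cases y rule: oct_cases) (simp add: algebra_simps)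

lemma oct_cnj_imag:
  assumes "fst (fst x) = 0"
  shows "oct_cnj x = - x"
  using assms by (cases x rule: oct_cases) (simp add: algebra_simps)

text \<open>
  Polarising \<open>x x = - \<parallel>x\<parallel>\<^sup>2\<close> for imaginary \<open>x\<close>, together with the alternative laws
  \<open>x (x z) = (x x) z\<close> and \<open>(z x) x = z (x x)\<close>, shows that orthogonal imaginary
  octonions may be exchanged at the cost of a sign, both as factors and as successive left or right
  multipliers.
\<close>

lemma oct_mult_imag_anticommute:
  assumes "fst (fst x) = 0" "fst (fst y) = 0"
  shows "oct_mult x y = - oct_mult y x - (2 * (x \<bullet> y)) *\<^sub>R ((1, 0), 0)"
  using assms by (cases x rule: oct_cases; cases y rule: oct_cases) (simp add: algebra_simps zero_prod_def)

lemma oct_mult_imag_swap_left: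
  assumes "fst (fst x) = 0" "fst (fst y) = 0"
  shows "oct_mult x (oct_mult y z) = - oct_mult y (oct_mult x z) - (2 * (x \<bullet> y)) *\<^sub>R z"
  using assms by (cases x rule: oct_cases; cases y rule: oct_cases; cases z rule: oct_cases) (simp add: algebra_simps)

lemma oct_mult_imag_swap_right:
  assumes "fst (fst x) = 0" "fst (fst y) = 0"
  shows "oct_mult (oct_mult z x) y = - oct_mult (oct_mult z y) x - (2 * (x \<bullet> y)) *\<^sub>R z"
  using assms by (cases x rule: oct_cases; cases y rule: oct_cases; cases z rule: oct_cases) (simp add: algebra_simps)

section \<open>Left zero-divisors of the sedenions\<close>

lemma Pair_eq_0_iff: "(x, y) = 0 \<longleftrightarrow> x = 0 \<and> y = 0"
  by (simp only: zero_prod_def prod.inject)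

lemma sed_mult_eq_0_iff:
  "sed_mult (a, b) (c, d) = 0 \<longleftrightarrow>
    oct_mult a c = oct_mult (oct_cnj d) b \<and> oct_mult d a = - oct_mult b (oct_cnj c)"
  by (simp add: Pair_eq_0_iff eq_neg_iff_add_eq_0)

text \<open>
  Pair the equations \<open>a c = d\<^sup>* b\<close> and \<open>d a = - b c\<^sup>*\<close> with \<open>c\<close> and \<open>d\<close>, with \<open>d\<^sup>*\<close> and \<open>c\<^sup>*\<close>,
  and with \<open>b c\<close> and \<open>d b\<close>. One equation then yields \<open>t \<parallel>c\<parallel>\<^sup>2\<close> and the other \<open>t \<parallel>d\<parallel>\<^sup>2\<close>, where \<open>t\<close> is
  \<open>Re a\<close>, \<open>Re b\<close> and \<open>\<langle>a, b\<rangle>\<close> respectively, and by adjointness (in the third case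
  also by flexibility and because \<open>b\<close> is imaginary) the two values are opposite. Comparing norms in the two equations gives
  \<open>\<parallel>a\<parallel>\<^sup>2 \<parallel>c\<parallel>\<^sup>2 = \<parallel>b\<parallel>\<^sup>2 \<parallel>d\<parallel>\<^sup>2\<close> and \<open>\<parallel>a\<parallel>\<^sup>2 \<parallel>d\<parallel>\<^sup>2 = \<parallel>b\<parallel>\<^sup>2 \<parallel>c\<parallel>\<^sup>2\<close>. In all four cases the
  factor \<open>\<parallel>c\<parallel>\<^sup>2 + \<parallel>d\<parallel>\<^sup>2 > 0\<close> can be cancelled after adding.
\<close>

lemma zero_divisor_necessary:
  assumes zero: "sed_mult (a, b) (c, d) = 0" and nz: "(c, d) \<noteq> 0"
  shows "fst (fst a) = 0" "fst (fst b) = 0" "a \<bullet> b = 0" "a \<bullet> a = b \<bullet> b"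
proof -
  have eq1: "oct_mult a c = oct_mult (oct_cnj d) b" and eq2: "oct_mult d a = - oct_mult b (oct_cnj c)"
    using zero unfolding sed_mult_eq_0_iff by auto
  have pos: "c \<bullet> c + d \<bullet> d \<noteq> 0"
    using nz inner_ge_zero[of c] inner_ge_zero[of d] by (auto simp: Pair_eq_0_iff add_nonneg_eq_0_iff)
  have cnj: "oct_cnj x \<bullet> oct_cnj x = x \<bullet> x" for x by (simp add: oct_inner_cnj)
  have "fst (fst a) * (c \<bullet> c) = oct_mult (oct_cnj d) b \<bullet> c"
    by (simp add: oct_mult_inner_self_left flip: eq1)
  also have "\<dots> = oct_mult b (oct_cnj c) \<bullet> d"
    by (simp add: oct_mult_adjoint_left[of "oct_cnj d"] oct_mult_adjoint_right[of b])
  also have "\<dots> = - (fst (fst a) * (d \<bullet> d))"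
    using oct_mult_inner_self_right[of d a] by (simp add: eq2)
  finally have "fst (fst a) * (c \<bullet> c + d \<bullet> d) = 0" by (simp add: algebra_simps)
  then show a: "fst (fst a) = 0" using pos by simp
  have "fst (fst b) * (d \<bullet> d) = oct_mult a c \<bullet> oct_cnj d"
    by (simp add: eq1 oct_mult_inner_self_right cnj)
  also have "\<dots> = oct_mult d a \<bullet> oct_cnj c"
    by (simp add: oct_mult_adjoint_left[of d] oct_mult_adjoint_right[of a])
  also have "\<dots> = - (fst (fst b) * (c \<bullet> c))"
    by (simp add: eq2 oct_mult_inner_self_left cnj)
  finally have "fst (fst b) * (c \<bullet> c + d \<bullet> d) = 0" by (simp add: algebra_simps)
  then show b: "fst (fst b) = 0" using pos by simp
  have "(a \<bullet> b) * (c \<bullet> c) = oct_mult (oct_cnj d) b \<bullet> oct_mult b c"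
    by (simp add: oct_mult_inner_right flip: eq1)
  also have "\<dots> = - (c \<bullet> oct_mult b (oct_mult (oct_cnj d) b))"
    by (subst inner_commute, subst oct_mult_adjoint_left)
      (simp add: oct_cnj_imag[OF b] oct_mult_minus_left)
  finally have 1: "(a \<bullet> b) * (c \<bullet> c) = - (c \<bullet> oct_mult b (oct_mult (oct_cnj d) b))" .
  have "(a \<bullet> b) * (d \<bullet> d) = - (oct_mult b (oct_cnj c) \<bullet> oct_mult d b)"
    using oct_mult_inner_left[of d a b] by (simp add: eq2)
  also have "\<dots> = oct_cnj c \<bullet> oct_mult b (oct_mult d b)"
    by (subst oct_mult_adjoint_left) (simp add: oct_cnj_imag[OF b] oct_mult_minus_left)
  also have "\<dots> = c \<bullet> oct_mult (oct_mult b (oct_cnj d)) b"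
    by (simp add: oct_inner_cnj oct_cnj_mult oct_cnj_imag[OF b] oct_mult_minus_left oct_mult_minus_right)
  finally have "(a \<bullet> b) * (c \<bullet> c + d \<bullet> d) = 0"
    using 1 by (simp add: oct_flexible distrib_left)
  then show "a \<bullet> b = 0" using pos by simp
  have "(a \<bullet> a) * (c \<bullet> c) = (b \<bullet> b) * (d \<bullet> d)"
    using oct_mult_inner_right[of a c a] oct_mult_inner_right[of "oct_cnj d" b "oct_cnj d"]
    by (simp add: eq1 cnj mult.commute)
  moreover have "(a \<bullet> a) * (d \<bullet> d) = (b \<bullet> b) * (c \<bullet> c)"
    using oct_mult_inner_right[of d a d] oct_mult_inner_right[of b "oct_cnj c" b]
    by (simp add: eq2 cnj)
  ultimately have "(a \<bullet> a) * (c \<bullet> c + d \<bullet> d) = (b \<bullet> b) * (c \<bullet> c + d \<bullet> d)"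
    by (simp add: algebra_simps)
  then show "a \<bullet> a = b \<bullet> b" using pos by simp
qed

text \<open>
  For every \<open>e\<close> the pair \<open>c = (e a)\<^sup>*\<close>, \<open>d = b e\<close> satisfies \<open>a c = d\<^sup>* b\<close>, as both sides equal
  \<open>\<parallel>a\<parallel>\<^sup>2 e\<^sup>* = \<parallel>b\<parallel>\<^sup>2 e\<^sup>*\<close>. The other equation then reads \<open>(b e) a = - b (e a)\<close>, an
  anti-associativity which holds as soon as \<open>e\<close> is orthogonal to \<open>1, a, b, b a\<close>; such an \<open>e \<noteq> 0\<close>
  exists because four vectors do not span the eight-dimensional algebra.
\<close>

lemma zero_divisor_sufficient:
  assumes a: "fst (fst a) = 0" and b: "fst (fst b) = 0" and ab: "a \<bullet> b = 0" and n: "a \<bullet> a = b \<bullet> b"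
    and nz: "b \<noteq> 0"
  shows "left_zero_divisor (a, b)"
proof -
  let ?one = "((1, 0), 0) :: oct" and ?ba = "oct_mult b a"
  have "dim {?one, a, b, ?ba} \<le> card {?one, a, b, ?ba}" by (rule dim_le_card') simp
  also have "\<dots> \<le> 4" by (simp add: card_insert_if)
  finally have "dim {?one, a, b, ?ba} < DIM(oct)" by simp
  then obtain e where e: "e \<noteq> 0" "\<And>y. y \<in> span {?one, a, b, ?ba} \<Longrightarrow> orthogonal e y"
    by (rule orthogonal_to_subspace_exists) blast
  have "e \<bullet> ?one = 0" "e \<bullet> a = 0" "e \<bullet> b = 0" and eba: "e \<bullet> ?ba = 0"
    using e(2) unfolding orthogonal_def by (meson insertI1 insertI2 span_base)+
  then have e0: "fst (fst e) = 0" and ea: "e \<bullet> a = 0" and eb: "e \<bullet> b = 0"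
    by (auto simp: inner_prod_def)
  have ba0: "fst (fst ?ba) = 0" using ab by (simp add: Re_oct_mult_imag[OF b a] inner_commute)
  have "oct_mult (oct_mult b e) a = - oct_mult ?ba e"
    using oct_mult_imag_swap_right[OF e0 a, of b] ea by simp
  also have "\<dots> = oct_mult e ?ba"
    using oct_mult_imag_anticommute[OF ba0 e0] eba by (simp add: inner_commute flip: zero_prod_def)
  also have "\<dots> = - oct_mult b (oct_mult e a)"
    using oct_mult_imag_swap_left[OF e0 b, of a] eb by simp
  finally have anti: "oct_mult (oct_mult b e) a = - oct_mult b (oct_mult e a)" .
  have "sed_mult (a, b) (oct_cnj (oct_mult e a), oct_mult b e) = 0"
    using anti n unfolding sed_mult_eq_0_iff
    by (simp add: oct_cnj_mult oct_mult_cnj_cancel_left oct_mult_cnj_cancel_right)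
  moreover have "oct_mult b e \<noteq> 0"
  proof
    assume "oct_mult b e = 0"
    then have "(b \<bullet> b) * (e \<bullet> e) = 0" by (metis oct_mult_inner_left inner_zero_left)
    then show False using nz e(1) by simp
  qed
  then have "(oct_cnj (oct_mult e a), oct_mult b e) \<noteq> 0" by (simp add: Pair_eq_0_iff)
  ultimately show ?thesis unfolding left_zero_divisor_def by blast
qed

theorem nontrivial_left_zero_divisors_iff:
  "(a, b) \<in> nontrivial_left_zero_divisors \<longleftrightarrow>
    fst (fst a) = 0 \<and> fst (fst b) = 0 \<and> a \<bullet> b = 0 \<and> a \<bullet> a = b \<bullet> b \<and> a \<noteq> 0"
  (is "?L \<longleftrightarrow> ?R")
proof
  assume ?L
  then obtain y where y: "y \<noteq> 0" "sed_mult (a, b) y = 0" and nz: "(a, b) \<noteq> 0"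
    by (auto simp: nontrivial_left_zero_divisors_def left_zero_divisor_def)
  obtain c d where "y = (c, d)" by (cases y)
  with zero_divisor_necessary[of a b c d] y nz show ?R by (auto simp: Pair_eq_0_iff)
next
  assume ?R
  then have "b \<noteq> 0" by auto
  with \<open>?R\<close> show ?L using zero_divisor_sufficient[of a b]
    by (simp add: nontrivial_left_zero_divisors_def Pair_eq_0_iff)
qed

section \<open>The three submanifolds\<close>

text \<open>
  Moving \<open>x\<close> and \<open>y\<close> along themselves changes their lengths, and moving \<open>y\<close> along \<open>x\<close> changes the
  angle; at an orthonormal pair these three effects do not interfere.
\<close>

lemma surj_stiefel_derivative:
  assumes "x \<bullet> x = 1" "y \<bullet> y = 1" "x \<bullet> y = 0"
  shows "surj (\<lambda>(h, k). (2 * (x \<bullet> h), 2 * (y \<bullet> k), x \<bullet> k + h \<bullet> y))"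
proof (rule surjI)
  fix c :: "real \<times> real \<times> real"
  show "(\<lambda>(h, k). (2 * (x \<bullet> h), 2 * (y \<bullet> k), x \<bullet> k + h \<bullet> y))
      ((fst c / 2) *\<^sub>R x, (fst (snd c) / 2) *\<^sub>R y + snd (snd c) *\<^sub>R x) = c"
    using assms by (simp add: inner_add_right inner_commute[of y x])
qed

theorem stiefel2_submanifold:
  assumes "d + 3 = 2 * DIM('a::euclidean_space)"
  shows "embedded_submanifold d (stiefel2 :: ('a \<times> 'a) set)"
proof -
  let ?F = "\<lambda>z :: 'a \<times> 'a. (fst z \<bullet> fst z, snd z \<bullet> snd z, fst z \<bullet> snd z)"
  have "embedded_submanifold d {z \<in> UNIV. ?F z = (1, 1, 0)}"
  proof (rule regular_level_set_submanifold[where F' = "\<lambda>p (h, k).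
        (2 * (fst p \<bullet> h), 2 * (snd p \<bullet> k), fst p \<bullet> k + h \<bullet> snd p)"])
    show "d + DIM(real \<times> real \<times> real) = DIM('a \<times> 'a)" using assms by simp
    show "Ck_on k ?F UNIV" for k
      by (intro Ck_on_Pair Ck_on_inner Ck_on_linear linear_fst linear_snd)
    fix p :: "'a \<times> 'a" assume "?F p = (1, 1, 0)"
    then show "surj (\<lambda>(h, k). (2 * (fst p \<bullet> h), 2 * (snd p \<bullet> k), fst p \<bullet> k + h \<bullet> snd p))"
      by (intro surj_stiefel_derivative) auto
  qed (auto intro!: derivative_eq_intros simp: inner_commute case_prod_beta)
  moreover have "stiefel2 = {z \<in> UNIV. ?F z = (1, 1, 0)}"
    by (auto simp: stiefel2_def norm_eq_1)
  ultimately show ?thesis by simp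
qed

theorem positive_times_stiefel2_submanifold:
  assumes "d + 2 = 2 * DIM('a::euclidean_space)"
  shows "embedded_submanifold d (({0<..} :: real set) \<times> (stiefel2 :: ('a \<times> 'a) set))"
proof -
  let ?F = "\<lambda>z :: real \<times> 'a \<times> 'a.
      (fst (snd z) \<bullet> fst (snd z), snd (snd z) \<bullet> snd (snd z), fst (snd z) \<bullet> snd (snd z))"
  let ?F' = "\<lambda>p :: real \<times> 'a \<times> 'a. \<lambda>(h, k).
      (2 * (fst (snd p) \<bullet> h), 2 * (snd (snd p) \<bullet> k), fst (snd p) \<bullet> k + h \<bullet> snd (snd p))"
  have "embedded_submanifold d {z \<in> {0<..} \<times> UNIV. ?F z = (1, 1, 0)}"
  proof (rule regular_level_set_submanifold[where F' = "\<lambda>p h. ?F' p (snd h)"])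
    show "d + DIM(real \<times> real \<times> real) = DIM(real \<times> 'a \<times> 'a)" using assms by simp
    show "open ({0 :: real<..} \<times> (UNIV :: ('a \<times> 'a) set))" by (intro open_Times) auto
    show "Ck_on k ?F U" for k U
      by (intro Ck_on_Pair Ck_on_inner Ck_on_linear
          linear_compose[OF linear_snd linear_fst, unfolded o_def]
          linear_compose[OF linear_snd linear_snd, unfolded o_def])
    fix p :: "real \<times> 'a \<times> 'a" assume "?F p = (1, 1, 0)"
    then have 1: "surj (?F' p)" by (intro surj_stiefel_derivative) auto
    have 2: "surj (snd :: real \<times> 'a \<times> 'a \<Rightarrow> _)" by (rule surjI[of _ "Pair 0"]) simp
    show "surj (\<lambda>h :: real \<times> 'a \<times> 'a. ?F' p (snd h))"
      using comp_surj[OF 2 1] by (simp only: o_def)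
  qed (auto intro!: derivative_eq_intros simp: inner_commute case_prod_beta)
  moreover have "{0<..} \<times> stiefel2 = {z \<in> {0<..} \<times> UNIV. ?F z = (1, 1, 0)}"
    by (auto simp: stiefel2_def norm_eq_1)
  ultimately show ?thesis by simp
qed

lemma linear_oct_Re: "linear (\<lambda>x :: oct. fst (fst x))"
  using linear_compose[OF linear_fst linear_fst] by (simp add: o_def)

lemma open_fst_nonzero: "open {v :: sed. fst v \<noteq> 0}"
  by (intro open_Collect_neq continuous_intros)

text \<open>
  Removing the points with \<open>a = 0\<close> makes \<open>0\<close> a regular value of the four equations
  \<open>Re a = Re b = 0\<close>, \<open>\<parallel>a\<parallel>\<^sup>2 = \<parallel>b\<parallel>\<^sup>2\<close>, \<open>\<langle>a, b\<rangle> = 0\<close>, whence the dimension \<open>16 - 4\<close>.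
\<close>

theorem zero_divisors_submanifold: "embedded_submanifold 12 nontrivial_left_zero_divisors"
proof -
  let ?F = "\<lambda>v :: sed. (fst (fst (fst v)), fst (fst (snd v)), fst v \<bullet> fst v + - 1 * (snd v \<bullet> snd v), fst v \<bullet> snd v)"
  let ?F' = "\<lambda>v :: sed. \<lambda>(h :: oct, k :: oct). (fst (fst h), fst (fst k),
      2 * (fst v \<bullet> h) - 2 * (snd v \<bullet> k), fst v \<bullet> k + h \<bullet> snd v)"
  have "embedded_submanifold 12 {v \<in> {v. fst v \<noteq> 0}. ?F v = (0, 0, 0, 0)}"
  proof (rule regular_level_set_submanifold[OF _ open_fst_nonzero, where F' = ?F'])
    show "12 + DIM(real \<times> real \<times> real \<times> real) = DIM(sed)" by simp
    show "Ck_on k ?F U" for k U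
      by (intro Ck_on_Pair Ck_on_add Ck_on_mult Ck_on_const Ck_on_inner Ck_on_linear linear_fst linear_snd
          linear_compose[OF linear_fst linear_oct_Re, unfolded o_def]
          linear_compose[OF linear_snd linear_oct_Re, unfolded o_def])
    fix v assume "v \<in> {v. fst v \<noteq> 0}" "?F v = (0, 0, 0, 0)"
    moreover obtain a b where v: "v = (a, b)" by (cases v)
    ultimately have Re: "fst (fst a) = 0" "fst (fst b) = 0" and orth: "a \<bullet> b = 0"
      and n: "a \<bullet> a \<noteq> 0" by auto
    show "surj (?F' v)"
    proof (rule surjI)
      fix c :: "real \<times> real \<times> real \<times> real"
      \<comment> \<open>The real parts of \<open>a\<close> and \<open>b\<close> are moved by the unit octonion, which is orthogonal to
        \<open>a\<close> and \<open>b\<close>; moving \<open>a\<close> along itself changes \<open>\<parallel>a\<parallel>\<^sup>2 - \<parallel>b\<parallel>\<^sup>2\<close>, and moving \<open>b\<close> along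
        \<open>a\<close> changes \<open>\<langle>a, b\<rangle>\<close>.\<close>
      let ?one = "((1, 0), 0) :: oct"
      obtain \<alpha> \<beta> \<gamma> \<delta> where c: "c = (\<alpha>, \<beta>, \<gamma>, \<delta>)" by (cases c)
      have one: "a \<bullet> ?one = 0" "?one \<bullet> b = 0" "b \<bullet> ?one = 0"
        using Re by (simp_all add: inner_prod_def)
      show "?F' v (fst c *\<^sub>R ?one + (fst (snd (snd c)) / (2 * (a \<bullet> a))) *\<^sub>R a,
          fst (snd c) *\<^sub>R ?one + (snd (snd (snd c)) / (a \<bullet> a)) *\<^sub>R a) = c"
        using n orth
        by (simp add: c v Re inner_add_left inner_add_right one inner_commute[of b a]
            del: inner_Pair scaleR_Pair)
    qed
  qed (auto intro!: derivative_eq_intros simp: inner_commute case_prod_beta)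
  moreover have "nontrivial_left_zero_divisors = {v \<in> {v. fst v \<noteq> 0}. ?F v = (0, 0, 0, 0)}"
    by (auto simp: nontrivial_left_zero_divisors_iff)
  ultimately show ?thesis by simp
qed

section \<open>Polar coordinates on the zero-divisors\<close>

lemma isometry_Im_oct:
  obtains \<pi> :: "oct \<Rightarrow> real^7" and \<iota> :: "real^7 \<Rightarrow> oct"
  where "linear \<pi>" "linear \<iota>" "\<And>u. fst (fst (\<iota> u)) = 0" "\<And>u. \<pi> (\<iota> u) = u"
    "\<And>x. fst (fst x) = 0 \<Longrightarrow> \<iota> (\<pi> x) = x" "\<And>u w. \<iota> u \<bullet> \<iota> w = u \<bullet> w"
proof -
  let ?S = "{x :: oct. fst (fst x) = 0}"
  have S: "subspace ?S" using linear_oct_Re by (rule linear_subspace_kernel)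
  have "surj (\<lambda>x :: oct. fst (fst x))" by (rule surjI[of _ "\<lambda>r. ((r, 0), 0)"]) simp
  then have "dim ?S + DIM(real) = DIM(oct)"
    using dim_kernel_surjective[OF linear_oct_Re] by blast
  then have "dim ?S = dim (UNIV :: (real^7) set)" by simp
  then obtain \<pi> :: "oct \<Rightarrow> real^7" and \<iota> where *: "linear \<pi>" "linear \<iota>" "\<pi> ` ?S = UNIV" "\<iota> ` UNIV = ?S"
      "\<And>x. x \<in> UNIV \<Longrightarrow> norm (\<iota> x) = norm x" "\<And>x. x \<in> ?S \<Longrightarrow> \<iota> (\<pi> x) = x"
      "\<And>x. x \<in> UNIV \<Longrightarrow> \<pi> (\<iota> x) = x"
    by (rule isometries_subspaces[OF S subspace_UNIV]) blast
  have "\<iota> u \<bullet> \<iota> w = u \<bullet> w" for u w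
    using *(5) by (simp add: dot_norm flip: linear_add[OF *(2)])
  with * that[of \<pi> \<iota>] show ?thesis by auto
qed

text \<open>
  Polar coordinates: \<open>(a, b)\<close> corresponds to the common norm \<open>r\<close> of \<open>a\<close> and \<open>b\<close> and to the orthonormal
  pair \<open>(a / r, b / r)\<close> of imaginary octonions. Both directions are given by formulas that are
  smooth on open sets of the ambient spaces.
\<close>

theorem zero_divisors_diffeomorphic:
  "nontrivial_left_zero_divisors diffeomorphic
     ({0<..} :: real set) \<times> (stiefel2 :: ((real^7) \<times> (real^7)) set)"
proof -
  obtain \<pi> :: "oct \<Rightarrow> real^7" and \<iota> where lin: "linear \<pi>" "linear \<iota>"
    and Re\<iota>: "\<And>u. fst (fst (\<iota> u)) = 0" and \<pi>\<iota>: "\<And>u. \<pi> (\<iota> u) = u"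
    and \<iota>\<pi>: "\<And>x. fst (fst x) = 0 \<Longrightarrow> \<iota> (\<pi> x) = x" and inner\<iota>: "\<And>u w. \<iota> u \<bullet> \<iota> w = u \<bullet> w"
    by (rule isometry_Im_oct) blast
  have norm\<iota>: "norm (\<iota> u) = norm u" for u by (simp add: norm_eq_sqrt_inner inner\<iota>)
  have inner\<pi>: "\<pi> x \<bullet> \<pi> y = x \<bullet> y" if "fst (fst x) = 0" "fst (fst y) = 0" for x y
    using that \<iota>\<pi> inner\<iota> by metis
  define f where "f v = (norm (fst v), inverse (norm (fst v)) *\<^sub>R \<pi> (fst v),
      inverse (norm (fst v)) *\<^sub>R \<pi> (snd v))" for v :: sed
  define g where "g z = (fst z *\<^sub>R \<iota> (fst (snd z)), fst z *\<^sub>R \<iota> (snd (snd z)))" for z :: "real \<times> (real^7) \<times> (real^7)"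
  let ?Z = nontrivial_left_zero_divisors and ?P = "({0<..} :: real set) \<times> (stiefel2 :: ((real^7) \<times> (real^7)) set)"
  have smooth_f: "smooth_map ?Z f"
  proof (rule smooth_map_open[OF open_fst_nonzero])
    fix k
    have norm: "Ck_on k (\<lambda>v. norm (fst v)) {v :: sed. fst v \<noteq> 0}"
      by (rule Ck_on_compose[OF open_fst_nonzero Ck_on_linear[OF linear_fst] Ck_on_norm]) auto
    have "Ck_on k (\<lambda>v. inverse (norm (fst v))) {v :: sed. fst v \<noteq> 0}"
      by (rule Ck_on_compose[OF open_fst_nonzero norm Ck_on_inverse]) auto
    then show "Ck_on k f {v. fst v \<noteq> 0}"
      unfolding f_def
      by (intro Ck_on_Pair norm Ck_on_scaleR
          Ck_on_linear[OF linear_compose[OF linear_fst lin(1), unfolded o_def]]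
          Ck_on_linear[OF linear_compose[OF linear_snd lin(1), unfolded o_def]])
  qed (auto simp: nontrivial_left_zero_divisors_iff)
  have smooth_g: "smooth_map ?P g"
  proof (rule smooth_map_open[OF open_UNIV _ subset_UNIV])
    show "Ck_on k g UNIV" for k
      unfolding g_def
      by (intro Ck_on_Pair Ck_on_scaleR Ck_on_linear linear_fst
          linear_compose[OF linear_compose[OF linear_snd linear_fst] lin(2), unfolded o_def]
          linear_compose[OF linear_compose[OF linear_snd linear_snd] lin(2), unfolded o_def])
  qed
  have fP: "f v \<in> ?P" and gf: "g (f v) = v" if "v \<in> ?Z" for v
  proof -
    obtain a b where v: "v = (a, b)" by (cases v)
    have Re: "fst (fst a) = 0" "fst (fst b) = 0" and orth: "a \<bullet> b = 0" and eq: "a \<bullet> a = b \<bullet> b" and "a \<noteq> 0"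
      using that by (auto simp: v nontrivial_left_zero_divisors_iff)
    have "norm (\<pi> a) = norm a" "norm (\<pi> b) = norm a" "\<pi> a \<bullet> \<pi> b = 0"
      using Re orth eq by (simp_all add: norm_eq_sqrt_inner inner\<pi>)
    with \<open>a \<noteq> 0\<close> show "f v \<in> ?P" by (simp add: f_def v stiefel2_def)
    show "g (f v) = v"
      using \<open>a \<noteq> 0\<close> Re by (simp add: f_def g_def v linear_scale[OF lin(2)] \<iota>\<pi>)
  qed
  have gZ: "g z \<in> ?Z" and fg: "f (g z) = z" if "z \<in> ?P" for z
  proof -
    obtain r u w where z: "z = (r, u, w)" by (cases z)
    have r: "r > 0" and uw: "norm u = 1" "norm w = 1" "u \<bullet> w = 0"
      using that by (auto simp: z stiefel2_def)
    have "u \<bullet> u = 1" "w \<bullet> w = 1" using uw by (simp_all add: norm_eq_1)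
    moreover have "\<iota> u \<noteq> 0" using norm\<iota>[of u] uw by auto
    ultimately show "g z \<in> ?Z"
      using r uw by (simp add: g_def z nontrivial_left_zero_divisors_iff Re\<iota> inner\<iota>)
    show "f (g z) = z"
      using r uw by (simp add: f_def g_def z norm\<iota> linear_scale[OF lin(1)] \<pi>\<iota>)
  qed
  have "f ` ?Z = ?P"
    by (rule bij_betw_imp_surj_on, rule bij_betw_byWitness[where f' = g];
        intro ballI image_subsetI fP gf gZ fg)
  moreover have "g ` ?P = ?Z"
    by (rule bij_betw_imp_surj_on, rule bij_betw_byWitness[where f' = f];
        intro ballI image_subsetI fP gf gZ fg)
  ultimately have "diffeomorphism ?Z ?P f g"
    unfolding diffeomorphism_def by (intro conjI ballI smooth_f smooth_g gf fg)
  then show ?thesis unfolding diffeomorphic_def by blast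
qed

theorem theorem4p2:
  shows "nontrivial_left_zero_divisors diffeomorphic
           ({0<..} :: real set) \<times> (stiefel2 :: ((real^7) \<times> (real^7)) set) \<and>
         embedded_submanifold (2 * 7 - 3) (stiefel2 :: ((real^7) \<times> (real^7)) set) \<and>
         embedded_submanifold (1 + (2 * 7 - 3))
           (({0<..} :: real set) \<times> (stiefel2 :: ((real^7) \<times> (real^7)) set)) \<and>
         embedded_submanifold 12 nontrivial_left_zero_divisors"
  by (intro conjI zero_divisors_diffeomorphic zero_divisors_submanifold
      stiefel2_submanifold positive_times_stiefel2_submanifold) simp_all

end
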